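(* For any positive integer $n$, there exist a compact metric space $M$ and a group $G$ with a proper isometric action on $M$ such that for any $\delta>0$, there is a $G$-invariant subset $X\subseteq M$ with $d_{\mathrm{H}}(X,M)<\delta$, $d_{\mathrm{GH}}(X,M)>0$, and $$\frac{d_{\mathrm{GH}}(X/G,M/G)}{d_{\mathrm{GH}}(X,M)} \ge n.$$
   Context: An action of a group $G$ on a metric space $(M,d)$ is isometric if for every $g\in G$ the map $x\mapsto g\cdot x$ preserves distances. It is proper if for each $x\in M$ there is some $r>0$ such that the set $\{g\in G : (g\cdot B(x,r))\cap B(x,r)\neq\emptyset\}$ is finite, where $B(x,r)$ is the ball of radius $r$ about $x$ (in particular any isometric action of a finite group is proper). A subset $X\subseteq M$ is $G$-invariant if $X=G\cdot X:=\{g\cdot x : g\in G,\ x\in X\}$. For a proper isometric action, the orbit space $M/G$ carries the quotient metric $d_{M/G}([x],[x'])=\inf_{g\in G} d(x,g\cdot x')$, where $[x]$ denotes the orbit of $x$; for $G$-invariant $X\subseteq M$, $X/G\subseteq M/G$ is the set of orbits of points of $X$, with the restricted metric. The subset $X\subseteq M$ is a metric space with the restricted metric. For subsets $X,Y$ of a metric space $(Z,d)$, the $\varepsilon$-thickening of $X$ is $X^\varepsilon=\{z\in Z : d(z,x)<\varepsilon \text{ for some } x\in X\}$, and the Hausdorff distance is $d_{\mathrm{H}}(X,Y)=\inf\{\varepsilon>0 : X\subseteq Y^\varepsilon \text{ and } Y\subseteq X^\varepsilon\}$. All metric spaces whose Gromov--Hausdorff distance is taken are nonempty. The Gromov--Hausdorff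 distance $d_{\mathrm{GH}}(X,Y)$ between metric spaces $X$ and $Y$ is the infimum, over all metric spaces $Z$ and all distance-preserving maps $f\colon X\to Z$ and $g\colon Y\to Z$, of the Hausdorff distance in $Z$ between $f(X)$ and $g(Y)$. Equivalently, $d_{\mathrm{GH}}(X,Y)=\frac12\inf_R \sup_{(x_1,y_1),(x_2,y_2)\in R}|d_X(x_1,x_2)-d_Y(y_1,y_2)|$, where $R$ ranges over all correspondences, i.e. subsets $R\subseteq X\times Y$ whose projections to $X$ and to $Y$ are both surjective. *)

theory Defs
  imports "HOL-Analysis.Abstract_Metric_Spaces" "HOL-Algebra.Group_Action"
begin

text \<open>A metric space is a carrier set with a distance function, as in the locale
  \<^locale>\<open>Metric_space\<close>; a subset of it is a metric space with the same distance function.\<close>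

section \<open>Proper isometric actions\<close>

definition isometric_action ::
    "('g, 'm) monoid_scheme \<Rightarrow> 'a set \<Rightarrow> ('a \<Rightarrow> 'a \<Rightarrow> real) \<Rightarrow> ('g \<Rightarrow> 'a \<Rightarrow> 'a) \<Rightarrow> bool" where
  "isometric_action G M d \<phi> \<longleftrightarrow>
     group_action G M \<phi> \<and>
     (\<forall>g\<in>carrier G. \<forall>x\<in>M. \<forall>y\<in>M. d (\<phi> g x) (\<phi> g y) = d x y)"

definition proper_action ::
    "('g, 'm) monoid_scheme \<Rightarrow> 'a set \<Rightarrow> ('a \<Rightarrow> 'a \<Rightarrow> real) \<Rightarrow> ('g \<Rightarrow> 'a \<Rightarrow> 'a) \<Rightarrow> bool" where
  "proper_action G M d \<phi> \<longleftrightarrow>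
     (\<forall>x\<in>M. \<exists>r>0. finite {g \<in> carrier G.
        \<phi> g ` Metric_space.mball M d x r \<inter> Metric_space.mball M d x r \<noteq> {}})"

definition invariant_subset ::
    "('g, 'm) monoid_scheme \<Rightarrow> ('g \<Rightarrow> 'a \<Rightarrow> 'a) \<Rightarrow> 'a set \<Rightarrow> bool" where
  "invariant_subset G \<phi> X \<longleftrightarrow> X = {\<phi> g x | g x. g \<in> carrier G \<and> x \<in> X}"

text \<open>The infimum over \<open>g\<close> of \<open>d x (\<phi> g x')\<close> for representatives \<open>x\<close>, \<open>x'\<close> of two orbits;
  for isometric actions it does not depend on the representatives, see \<open>orbit_dist_orbit\<close>.\<close>

definition orbit_dist ::
    "('g, 'm) monoid_scheme \<Rightarrow> ('a \<Rightarrow> 'a \<Rightarrow> real) \<Rightarrow> ('g \<Rightarrow> 'a \<Rightarrow> 'a) \<Rightarrow>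
     'a set \<Rightarrow> 'a set \<Rightarrow> real" where
  "orbit_dist G d \<phi> A B = (INF g\<in>carrier G. d (SOME x. x \<in> A) (\<phi> g (SOME x'. x' \<in> B)))"

lemma orbit_dist_orbit:
  fixes G (structure)
  assumes iso: "isometric_action G M d \<phi>" and x: "x \<in> M" and x': "x' \<in> M"
  shows "orbit_dist G d \<phi> (orbit G \<phi> x) (orbit G \<phi> x') = (INF g\<in>carrier G. d x (\<phi> g x'))"
proof -
  interpret group_action G M \<phi>
    using iso by (simp add: isometric_action_def)
  interpret group G
    using group_hom group_hom.axioms(1) by auto
  have d: "d (\<phi> g y) (\<phi> g z) = d y z" if "g \<in> carrier G" "y \<in> M" "z \<in> M" for g y z
    using iso that by (simp add: isometric_action_def)
  have "(SOME y. y \<in> orbit G \<phi> z) \<in> orbit G \<phi> z" if "z \<in> M" for z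
    using orbit_refl[OF that] by (rule someI)
  then obtain h k where h: "h \<in> carrier G" "(SOME y. y \<in> orbit G \<phi> x) = \<phi> h x"
    and k: "k \<in> carrier G" "(SOME y. y \<in> orbit G \<phi> x') = \<phi> k x'"
    using x x' by (simp add: orbit_def) blast
  have eq: "d (\<phi> h x) (\<phi> g (\<phi> k x')) = d x (\<phi> (inv h \<otimes> (g \<otimes> k)) x')"
    if g: "g \<in> carrier G" for g
  proof -
    have "\<phi> h (\<phi> (inv h \<otimes> (g \<otimes> k)) x') = \<phi> (h \<otimes> (inv h \<otimes> (g \<otimes> k))) x'"
      using g h k x' by (simp add: composition_rule)
    also have "h \<otimes> (inv h \<otimes> (g \<otimes> k)) = g \<otimes> k"
      using g h k by (simp flip: m_assoc)
    also have "\<phi> (g \<otimes> k) x' = \<phi> g (\<phi> k x')"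
      using g k x' by (simp add: composition_rule)
    finally have "\<phi> g (\<phi> k x') = \<phi> h (\<phi> (inv h \<otimes> (g \<otimes> k)) x')" ..
    moreover have "\<phi> (inv h \<otimes> (g \<otimes> k)) x' \<in> M"
      using g h k x' element_image by blast
    ultimately show ?thesis
      using d h x by simp
  qed
  have "(\<lambda>g. inv h \<otimes> (g \<otimes> k)) ` carrier G = carrier G"
  proof
    show "carrier G \<subseteq> (\<lambda>g. inv h \<otimes> (g \<otimes> k)) ` carrier G"
    proof
      fix g assume g: "g \<in> carrier G"
      have "inv h \<otimes> ((h \<otimes> g \<otimes> inv k) \<otimes> k) = inv h \<otimes> (h \<otimes> g)"
        using g h k by (simp add: m_assoc)
      also have "\<dots> = g"
        using g h k by (simp flip: m_assoc)
      finally show "g \<in> (\<lambda>g. inv h \<otimes> (g \<otimes> k)) ` carrier G"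
        using g h k by (intro image_eqI[where x = "h \<otimes> g \<otimes> inv k"]) auto
    qed
  qed (use h k in auto)
  then have "(\<lambda>g. d x (\<phi> g x')) ` carrier G =
      (\<lambda>g. d x (\<phi> (inv h \<otimes> (g \<otimes> k)) x')) ` carrier G"
    using image_image[of "\<lambda>g. d x (\<phi> g x')" "\<lambda>g. inv h \<otimes> (g \<otimes> k)" "carrier G"] by simp
  then show ?thesis
    using eq by (simp add: orbit_dist_def h(2) k(2) cong: image_cong)
qed

section \<open>Hausdorff and Gromov--Hausdorff distance\<close>

definition thickening :: "'a set \<Rightarrow> ('a \<Rightarrow> 'a \<Rightarrow> real) \<Rightarrow> 'a set \<Rightarrow> real \<Rightarrow> 'a set" where
  "thickening Z d X \<epsilon> = {z \<in> Z. \<exists>x\<in>X. d z x < \<epsilon>}"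

text \<open>Both distances are real infima, so they are meant for nonempty bounded spaces; otherwise
  the infimum defining \<open>hausdorff_dist\<close> may be over the empty set.\<close>

definition hausdorff_dist :: "'a set \<Rightarrow> ('a \<Rightarrow> 'a \<Rightarrow> real) \<Rightarrow> 'a set \<Rightarrow> 'a set \<Rightarrow> real" where
  "hausdorff_dist Z d X Y =
     Inf {\<epsilon>. \<epsilon> > 0 \<and> X \<subseteq> thickening Z d Y \<epsilon> \<and> Y \<subseteq> thickening Z d X \<epsilon>}"

definition dist_preserving ::
    "'a set \<Rightarrow> ('a \<Rightarrow> 'a \<Rightarrow> real) \<Rightarrow> 'b set \<Rightarrow> ('b \<Rightarrow> 'b \<Rightarrow> real) \<Rightarrow> ('a \<Rightarrow> 'b) \<Rightarrow> bool" where
  "dist_preserving X dX Z dZ f \<longleftrightarrow>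
     f \<in> X \<rightarrow> Z \<and> (\<forall>x\<in>X. \<forall>y\<in>X. dZ (f x) (f y) = dX x y)"

text \<open>The ambient space \<open>Z\<close> ranges over the metric spaces carried by the type \<open>'a + 'b\<close>. This is
  no restriction: any ambient space can be cut down to the union of the images of \<open>X\<close> and \<open>Y\<close>,
  which has a copy in \<open>'a + 'b\<close>. See \<open>gh_dist_le_hausdorff_dist\<close>.\<close>

definition gh_dist ::
    "'a set \<Rightarrow> ('a \<Rightarrow> 'a \<Rightarrow> real) \<Rightarrow> 'b set \<Rightarrow> ('b \<Rightarrow> 'b \<Rightarrow> real) \<Rightarrow> real" where
  "gh_dist X dX Y dY =
     Inf {hausdorff_dist Z dZ (f ` X) (g ` Y) |
            (Z :: ('a + 'b) set) dZ f g.
            Metric_space Z dZ \<and> dist_preserving X dX Z dZ f \<and> dist_preserving Y dY Z dZ g}"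

lemma gh_dist_le_hausdorff_dist:
  fixes X :: "'a set" and Y :: "'b set" and Z :: "'c set"
  assumes Z: "Metric_space Z dZ"
    and f: "dist_preserving X dX Z dZ f" and g: "dist_preserving Y dY Z dZ g"
  shows "gh_dist X dX Y dY \<le> hausdorff_dist Z dZ (f ` X) (g ` Y)"
proof -
  interpret Metric_space Z dZ by (rule Z)
  define p where "p = case_sum f g"
  define s where "s = inv_into (X <+> Y) p"
  define W where "W = s ` (f ` X \<union> g ` Y)"
  define dW where "dW u v = dZ (p u) (p v)" for u v
  have im: "p ` (X <+> Y) = f ` X \<union> g ` Y"
    by (auto simp: p_def image_iff Plus_def) force+
  have ps: "p (s z) = z" if "z \<in> f ` X \<union> g ` Y" for z
    using that unfolding s_def by (metis f_inv_into_f im)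
  have sub: "f ` X \<subseteq> Z" "g ` Y \<subseteq> Z"
    using f g by (auto simp: dist_preserving_def)
  have pW: "p u \<in> Z" "s (p u) = u" if "u \<in> W" for u
    using that ps sub unfolding W_def by auto
  have "Metric_space W dW"
  proof
    show "dW u v = 0 \<longleftrightarrow> u = v" if "u \<in> W" "v \<in> W" for u v
      using that pW unfolding dW_def by (metis zero)
    show "dW u w \<le> dW u v + dW v w" if "u \<in> W" "v \<in> W" "w \<in> W" for u v w
      using that pW unfolding dW_def by (simp add: triangle)
  qed (auto simp: dW_def commute)
  moreover have "dist_preserving X dX W dW (s \<circ> f)"
    using f ps by (auto simp: dist_preserving_def W_def dW_def)
  moreover have "dist_preserving Y dY W dW (s \<circ> g)"
    using g ps by (auto simp: dist_preserving_def W_def dW_def)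
  moreover have "hausdorff_dist W dW ((s \<circ> f) ` X) ((s \<circ> g) ` Y) =
      hausdorff_dist Z dZ (f ` X) (g ` Y)"
  proof -
    have "(s \<circ> f) ` X \<subseteq> thickening W dW ((s \<circ> g) ` Y) e \<longleftrightarrow> f ` X \<subseteq> thickening Z dZ (g ` Y) e"
      and "(s \<circ> g) ` Y \<subseteq> thickening W dW ((s \<circ> f) ` X) e \<longleftrightarrow> g ` Y \<subseteq> thickening Z dZ (f ` X) e" for e
      using sub ps by (auto simp: thickening_def W_def dW_def image_subset_iff)
    then show ?thesis
      by (simp add: hausdorff_dist_def)
  qed
  ultimately have mem: "hausdorff_dist Z dZ (f ` X) (g ` Y) \<in>
      {hausdorff_dist Z dZ (f ` X) (g ` Y) | (Z :: ('a + 'b) set) dZ f g.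
         Metric_space Z dZ \<and> dist_preserving X dX Z dZ f \<and> dist_preserving Y dY Z dZ g}"
    by (intro CollectI exI[of _ W] exI[of _ dW] exI[of _ "s \<circ> f"] exI[of _ "s \<circ> g"]) auto
  have lower: "min 0 (Inf {}) \<le> hausdorff_dist V dV A B" for V :: "('a + 'b) set" and dV A B
  proof (cases "{\<epsilon>. \<epsilon> > 0 \<and> A \<subseteq> thickening V dV B \<epsilon> \<and> B \<subseteq> thickening V dV A \<epsilon>} = {}")
    case True
    then show ?thesis by (simp only: hausdorff_dist_def)
  next
    case False
    then have "0 \<le> hausdorff_dist V dV A B"
      unfolding hausdorff_dist_def by (rule cInf_greatest) auto
    then show ?thesis by simp
  qed
  show ?thesis
    unfolding gh_dist_def
    by (rule cInf_lower[OF mem], rule bdd_belowI[where m = "min 0 (Inf {})"]) (use lower in auto)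
qed

end

theory Submission
  imports Defs
begin

text \<open>Let \<open>B\<close> consist of two fixed points \<open>p\<close> and \<open>q\<close> of an involution and of pairs \<open>P\<^sub>1, \<dots>, P\<^sub>N\<^sub>-\<^sub>1\<close>
  swapped by it, where the points of \<open>P\<^sub>i\<close> have distance \<open>i / N\<close> and all other distances are
  \<open>1\<close>. Deleting \<open>q\<close> hardly changes the metric space: splitting \<open>p\<close> into \<open>P\<^sub>1\<close>, stretching \<open>P\<^sub>i\<close> to
  \<open>P\<^sub>i\<^sub>+\<^sub>1\<close> and \<open>P\<^sub>N\<^sub>-\<^sub>1\<close> to \<open>{p, q}\<close> changes distances by at most \<open>1 / N\<close>. But the orbit spaces
  before and after have \<open>N + 1\<close> and \<open>N\<close> points, all at mutual distance \<open>1\<close>. Copies of \<open>B\<close> of rapidly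
  decreasing size, converging to a point, make the deletion possible at every scale.\<close>

section \<open>Estimates of the Gromov--Hausdorff distance\<close>

lemma hausdorff_dist_le:
  assumes "0 < e" "X \<subseteq> thickening Z d Y e" "Y \<subseteq> thickening Z d X e"
  shows "hausdorff_dist Z d X Y \<le> e"
  unfolding hausdorff_dist_def
  by (rule cInf_lower) (use assms in \<open>auto intro!: bdd_belowI[where m = 0]\<close>)

text \<open>Needed because the closed form of the orbit distance agrees with
  \<open>orbit_dist\<close> only on actual orbits.\<close>

lemma gh_dist_cong:
  assumes "\<And>x x'. x \<in> X \<Longrightarrow> x' \<in> X \<Longrightarrow> dX x x' = dX' x x'"
    and "\<And>y y'. y \<in> Y \<Longrightarrow> y' \<in> Y \<Longrightarrow> dY y y' = dY' y y'"
  shows "gh_dist X dX Y dY = gh_dist X dX' Y dY'"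
proof -
  have "dist_preserving X dX = (dist_preserving X dX' :: ('a + 'b) set \<Rightarrow> _)"
    and "dist_preserving Y dY = (dist_preserving Y dY' :: ('a + 'b) set \<Rightarrow> _)"
    using assms by (auto simp: dist_preserving_def fun_eq_iff)
  then show ?thesis
    by (simp add: gh_dist_def)
qed

text \<open>The usual metric on a disjoint union that realises a correspondence, here the graph of
  \<open>F\<close>, of distortion at most \<open>2 * \<eta>\<close>: \<open>y\<close> is placed at
  distance \<open>\<eta>\<close> from \<open>F y\<close>.\<close>

definition glued_dist ::
    "('a \<Rightarrow> 'a \<Rightarrow> real) \<Rightarrow> ('b \<Rightarrow> 'b \<Rightarrow> real) \<Rightarrow> ('b \<Rightarrow> 'a) \<Rightarrow> real \<Rightarrow> 'a + 'b \<Rightarrow> 'a + 'b \<Rightarrow> real" where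
  "glued_dist dX dY F \<eta> u v =
     (case u of
        Inl x \<Rightarrow> (case v of Inl x' \<Rightarrow> dX x x' | Inr y \<Rightarrow> dX x (F y) + \<eta>)
      | Inr y \<Rightarrow> (case v of Inl x \<Rightarrow> dX x (F y) + \<eta> | Inr y' \<Rightarrow> dY y y'))"

text \<open>Since \<open>F\<close> is a contraction, the distance from \<open>x\<close> to \<open>y\<close> may be measured along \<open>F y\<close>
  only; for a general correspondence it would have to be an infimum.\<close>

lemma Metric_space_glued_dist:
  assumes X: "Metric_space X dX" and Y: "Metric_space Y dY"
    and F: "\<And>y. y \<in> Y \<Longrightarrow> F y \<in> X" and \<eta>: "\<eta> > 0"
    and le: "\<And>y y'. y \<in> Y \<Longrightarrow> y' \<in> Y \<Longrightarrow> dX (F y) (F y') \<le> dY y y'"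
    and ge: "\<And>y y'. y \<in> Y \<Longrightarrow> y' \<in> Y \<Longrightarrow> dY y y' \<le> dX (F y) (F y') + 2 * \<eta>"
  shows "Metric_space (X <+> Y) (glued_dist dX dY F \<eta>)"
proof -
  interpret X: Metric_space X dX by (rule X)
  interpret Y: Metric_space Y dY by (rule Y)
  show ?thesis
  proof
    fix u v
    show "0 \<le> glued_dist dX dY F \<eta> u v"
      using \<eta> by (auto simp: glued_dist_def add_nonneg_nonneg split: sum.split)
    show "glued_dist dX dY F \<eta> u v = glued_dist dX dY F \<eta> v u"
      by (auto simp: glued_dist_def X.commute Y.commute split: sum.split)
  next
    fix u v assume "u \<in> X <+> Y" "v \<in> X <+> Y"
    moreover have "dX x x' + \<eta> \<noteq> 0" for x x'
      using \<eta> X.nonneg[of x x'] by linarith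
    ultimately show "glued_dist dX dY F \<eta> u v = 0 \<longleftrightarrow> u = v"
      by (auto simp: glued_dist_def)
  next
    fix u v w assume uvw: "u \<in> X <+> Y" "v \<in> X <+> Y" "w \<in> X <+> Y"
    \<comment> \<open>The mixed triangle inequalities, named after the sides of the three points.
      \<open>le\<close> enters in \<open>XYY\<close>; \<open>ge\<close> enters in
      \<open>YXY\<close>, where the two crossings pay the \<open>2 * \<eta>\<close>.\<close>
    have XYY: "dX x (F y) \<le> dX x (F y') + dY y' y"
      if "x \<in> X" "y \<in> Y" "y' \<in> Y" for x y y'
      using X.triangle[of x "F y'" "F y"] le[of y' y] F that by fastforce
    have YXY: "dY y y' \<le> (dX x (F y) + \<eta>) + (dX x (F y') + \<eta>)"
      if "x \<in> X" "y \<in> Y" "y' \<in> Y" for x y y'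
      using X.triangle[of "F y" x "F y'"] ge[of y y'] F that X.commute[of x "F y"] by fastforce
    have XYX: "dX x x' \<le> (dX x (F y) + \<eta>) + (dX x' (F y) + \<eta>)"
      if "x \<in> X" "x' \<in> X" "y \<in> Y" for x x' y
      using X.triangle[of x "F y" x'] F[OF that(3)] that \<eta> X.commute[of x' "F y"] by linarith
    have XXY: "dX x (F y) \<le> dX x x' + dX x' (F y)"
      if "x \<in> X" "x' \<in> X" "y \<in> Y" for x x' y
      using X.triangle[of x x' "F y"] F[OF that(3)] that by blast
    show "glued_dist dX dY F \<eta> u w \<le> glued_dist dX dY F \<eta> u v + glued_dist dX dY F \<eta> v w"
    proof (cases u; cases v; cases w)
      fix x x' x'' assume [simp]: "u = Inl x" "v = Inl x'" "w = Inl x''"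
      show ?thesis
        using uvw X.triangle[of x x' x''] by (auto simp: glued_dist_def)
    next
      fix x x' y assume [simp]: "u = Inl x" "v = Inl x'" "w = Inr y"
      show ?thesis
        using uvw XXY[of x x' y] by (auto simp: glued_dist_def)
    next
      fix x y x' assume [simp]: "u = Inl x" "v = Inr y" "w = Inl x'"
      show ?thesis
        using uvw XYX[of x x' y] by (auto simp: glued_dist_def)
    next
      fix x y y' assume [simp]: "u = Inl x" "v = Inr y" "w = Inr y'"
      show ?thesis
        using uvw XYY[of x y' y] by (auto simp: glued_dist_def)
    next
      fix y x x' assume [simp]: "u = Inr y" "v = Inl x" "w = Inl x'"
      show ?thesis
        using uvw XXY[of x' x y] X.commute[of x x'] by (auto simp: glued_dist_def)
    next
      fix y x y' assume [simp]: "u = Inr y" "v = Inl x" "w = Inr y'"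
      show ?thesis
        using uvw YXY[of x y y'] by (auto simp: glued_dist_def)
    next
      fix y y' x assume [simp]: "u = Inr y" "v = Inr y'" "w = Inl x"
      show ?thesis
        using uvw XYY[of x y y'] Y.commute[of y y'] by (auto simp: glued_dist_def)
    next
      fix y y' y'' assume [simp]: "u = Inr y" "v = Inr y'" "w = Inr y''"
      show ?thesis
        using uvw Y.triangle[of y y' y''] by (auto simp: glued_dist_def)
    qed
  qed
qed

lemma dist_preserving_Inl: "dist_preserving X dX (X <+> Y) (glued_dist dX dY F \<eta>) Inl"
  and dist_preserving_Inr: "dist_preserving Y dY (X <+> Y) (glued_dist dX dY F \<eta>) Inr"
  by (auto simp: dist_preserving_def glued_dist_def)

text \<open>In the glued metric \<open>y\<close> is at distance exactly \<open>\<eta>\<close> from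
  \<open>F y\<close>, and \<open>F\<close> is onto. As thickenings use a strict inequality, the
  bound is shown for every \<open>e > \<eta>\<close>.\<close>

lemma gh_dist_le_contraction:
  assumes X: "Metric_space X dX" and Y: "Metric_space Y dY"
    and F: "F ` Y = X" and \<eta>: "\<eta> > 0"
    and le: "\<And>y y'. y \<in> Y \<Longrightarrow> y' \<in> Y \<Longrightarrow> dX (F y) (F y') \<le> dY y y'"
    and ge: "\<And>y y'. y \<in> Y \<Longrightarrow> y' \<in> Y \<Longrightarrow> dY y y' \<le> dX (F y) (F y') + 2 * \<eta>"
  shows "gh_dist X dX Y dY \<le> \<eta>"
proof (rule dense_ge)
  fix e assume e: "\<eta> < e"
  interpret X: Metric_space X dX by (rule X)
  let ?d = "glued_dist dX dY F \<eta>"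
  have "gh_dist X dX Y dY \<le> hausdorff_dist (X <+> Y) ?d (Inl ` X) (Inr ` Y)"
    using F by (intro gh_dist_le_hausdorff_dist dist_preserving_Inl dist_preserving_Inr
        Metric_space_glued_dist assms) auto
  also have "\<dots> \<le> e"
  proof (rule hausdorff_dist_le)
    show "0 < e" using e \<eta> by simp
    show "Inl ` X \<subseteq> thickening (X <+> Y) ?d (Inr ` Y) e"
    proof clarify
      fix x assume "x \<in> X"
      moreover from this obtain y where "y \<in> Y" "x = F y" using F by blast
      ultimately show "Inl x \<in> thickening (X <+> Y) ?d (Inr ` Y) e"
        using e by (auto simp: thickening_def glued_dist_def intro!: bexI[of _ y])
    qed
    show "Inr ` Y \<subseteq> thickening (X <+> Y) ?d (Inl ` X) e"
    proof clarify
      fix y assume "y \<in> Y"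
      moreover from this have "F y \<in> X" using F by blast
      ultimately show "Inr y \<in> thickening (X <+> Y) ?d (Inl ` X) e"
        using e by (auto simp: thickening_def glued_dist_def intro!: bexI[of _ "F y"])
    qed
  qed
  finally show "gh_dist X dX Y dY \<le> e" .
qed

text \<open>Too few small pieces cannot be close to many separated points, by the pigeonhole principle;
  the map \<open>c\<close> names the piece to which a point belongs. Boundedness keeps the infima defining
  \<open>gh_dist\<close> away from the empty set.\<close>

lemma gh_dist_ge_pigeonhole:
  assumes X: "Metric_space X dX" and Y: "Metric_space Y dY" and "X \<noteq> {}"
    and bX: "\<And>x x'. x \<in> X \<Longrightarrow> x' \<in> X \<Longrightarrow> dX x x' \<le> B"
    and bY: "\<And>y y'. y \<in> Y \<Longrightarrow> y' \<in> Y \<Longrightarrow> dY y y' \<le> B"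
    and A: "A \<subseteq> Y" "finite A" "q \<in> A"
    and c: "\<And>x. x \<in> X \<Longrightarrow> c x \<in> A - {q}"
    and small: "\<And>x x'. x \<in> X \<Longrightarrow> x' \<in> X \<Longrightarrow> c x = c x' \<Longrightarrow> dX x x' \<le> s"
    and sep: "\<And>a b. a \<in> A \<Longrightarrow> b \<in> A \<Longrightarrow> a \<noteq> b \<Longrightarrow> s + 2 * \<eta> \<le> dY a b"
  shows "\<eta> \<le> gh_dist X dX Y dY"
proof -
  interpret X: Metric_space X dX by (rule X)
  interpret Y: Metric_space Y dY by (rule Y)
  obtain x0 where x0: "x0 \<in> X" using \<open>X \<noteq> {}\<close> by blast
  have B: "0 \<le> B" using bX[OF x0 x0] x0 by simp
  have haus: "\<eta> \<le> hausdorff_dist Z dZ (f ` X) (g ` Y)"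
    if Z: "Metric_space Z dZ" and f: "dist_preserving X dX Z dZ f"
      and g: "dist_preserving Y dY Z dZ g" for Z :: "('a + 'b) set" and dZ f g
  proof -
    interpret Z: Metric_space Z dZ by (rule Z)
    have fZ: "f x \<in> Z" "dZ (f x) (f x') = dX x x'" if "x \<in> X" "x' \<in> X" for x x'
      using f that by (auto simp: dist_preserving_def)
    have gZ: "g y \<in> Z" "dZ (g y) (g y') = dY y y'" if "y \<in> Y" "y' \<in> Y" for y y'
      using g that by (auto simp: dist_preserving_def)
    let ?E = "{e. e > 0 \<and> f ` X \<subseteq> thickening Z dZ (g ` Y) e \<and> g ` Y \<subseteq> thickening Z dZ (f ` X) e}"
    have q: "q \<in> Y" using A by blast
    \<comment> \<open>A radius that suffices for both thickenings: all of \<open>f\<close>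
      X\<open>is within it of\<close>g q\<open>, and all of\<close>g \<open>Y\<close> of
      \<open>f x0\<close>. So the infimum is over a nonempty set.\<close>
    define e where "e = dZ (f x0) (g q) + B + 1"
    have "dZ (f x) (g q) < e" if "x \<in> X" for x
      using Z.triangle[of "f x" "f x0" "g q"] fZ gZ that x0 q bX[of x x0] unfolding e_def by force
    moreover have "dZ (g y) (f x0) < e" if "y \<in> Y" for y
      using Z.triangle[of "g y" "g q" "f x0"] fZ gZ that x0 q bY[of y q] Z.commute[of "f x0" "g q"]
      unfolding e_def by force
    moreover have "0 < e" using B Z.nonneg[of "f x0" "g q"] unfolding e_def by linarith
    ultimately have "e \<in> ?E"
      using x0 q fZ gZ by (auto simp: thickening_def)
    moreover have "\<eta> \<le> e" if "e \<in> ?E" for e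
    proof (rule ccontr)
      assume "\<not> \<eta> \<le> e"
      have "\<forall>a\<in>A. \<exists>x\<in>X. dZ (g a) (f x) < e"
        using that A(1) by (fastforce simp: thickening_def)
      then obtain h where h: "\<And>a. a \<in> A \<Longrightarrow> h a \<in> X" "\<And>a. a \<in> A \<Longrightarrow> dZ (g a) (f (h a)) < e"
        by metis
      \<comment> \<open>Since \<open>c\<close> avoids \<open>q\<close>, there are fewer names than
        points of \<open>A\<close>, and two of these have their approximants \<open>h a\<close>,
        \<open>h b\<close> in the same piece.\<close>
      have "card ((\<lambda>a. c (h a)) ` A) \<le> card (A - {q})"
        using c h(1) A(2) by (intro card_mono) auto
      also have "\<dots> < card A"
        using A(2,3) by (rule card_Diff1_less)
      finally have "\<not> inj_on (\<lambda>a. c (h a)) A"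
        by (rule pigeonhole)
      then obtain a b where ab: "a \<in> A" "b \<in> A" "a \<noteq> b" "c (h a) = c (h b)"
        by (auto simp: inj_on_def)
      have Z_in: "g a \<in> Z" "g b \<in> Z" "f (h a) \<in> Z" "f (h b) \<in> Z"
        using ab A(1) h(1) fZ gZ by blast+
      \<comment> \<open>The path through both approximants is shorter than \<open>s + 2 * e\<close>,
        hence than \<open>s + 2 * \<eta>\<close>, against the separation of
        \<open>A\<close>.\<close>
      have "dY a b = dZ (g a) (g b)"
        using gZ(2)[of a b] ab(1,2) A(1) by (simp add: subset_iff)
      also have "\<dots> \<le> dZ (g a) (f (h a)) + (dZ (f (h a)) (f (h b)) + dZ (f (h b)) (g b))"
        using Z.triangle[of "g a" "f (h a)" "g b"] Z.triangle[of "f (h a)" "f (h b)" "g b"] Z_in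
        by linarith
      also have "\<dots> < e + (s + e)"
        using h(2)[OF ab(1)] h(2)[OF ab(2)] small[OF h(1)[OF ab(1)] h(1)[OF ab(2)] ab(4)]
          fZ(2)[OF h(1)[OF ab(1)] h(1)[OF ab(2)]] Z.commute[of "f (h b)" "g b"] by linarith
      finally show False
        using sep[OF ab(1-3)] \<open>\<not> \<eta> \<le> e\<close> by linarith
    qed
    ultimately show ?thesis
      unfolding hausdorff_dist_def by (intro cInf_greatest) auto
  qed
  \<comment> \<open>A common ambient space, so that the infimum in \<open>gh_dist\<close> is over a
    nonempty set: \<open>Y\<close> is collapsed to \<open>x0\<close>, and a gluing distance of
    \<open>B + 1\<close> is positive and satisfies \<open>ge\<close> by boundedness.\<close>
  have const: "Metric_space (X <+> Y) (glued_dist dX dY (\<lambda>_. x0) (B + 1))"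
    using x0 B by (intro Metric_space_glued_dist X Y) (auto intro: order_trans[OF bY])
  show ?thesis
    unfolding gh_dist_def
  proof (rule cInf_greatest)
    show "{hausdorff_dist Z dZ (f ` X) (g ` Y) | (Z :: ('a + 'b) set) dZ f g.
        Metric_space Z dZ \<and> dist_preserving X dX Z dZ f \<and> dist_preserving Y dY Z dZ g} \<noteq> {}"
      by (rule ex_in_conv[THEN iffD1], rule exI, rule CollectI, intro exI conjI, rule refl)
        (rule const dist_preserving_Inl dist_preserving_Inr)+
  qed (use haus in auto)
qed

section \<open>Actions by an isometric involution\<close>

text \<open>The group of order two, carried by constant functions because the theorem asks for a
  group on \<open>nat \<Rightarrow> nat\<close>.\<close>

definition Z2 :: "(nat \<Rightarrow> nat) monoid" where
  "Z2 = \<lparr>carrier = {\<lambda>_. 0, \<lambda>_. 1}, mult = (\<lambda>f g k. (f k + g k) mod 2), one = (\<lambda>_. 0)\<rparr>"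

text \<open>The restriction to \<open>M\<close> is there because elements of
  \<open>BijGroup M\<close> are extensional.\<close>

definition flip_action :: "'a set \<Rightarrow> ('a \<Rightarrow> 'a) \<Rightarrow> (nat \<Rightarrow> nat) \<Rightarrow> 'a \<Rightarrow> 'a" where
  "flip_action M \<sigma> g = (\<lambda>x\<in>M. if g = (\<lambda>_. 0) then x else \<sigma> x)"

lemma group_Z2: "group Z2"
  by (rule groupI) (auto simp: Z2_def fun_eq_iff)

lemma carrier_Z2: "carrier Z2 = {\<lambda>_. 0, \<lambda>_. 1}"
  by (simp add: Z2_def)

lemma const_0_1_nat [simp]: "(\<lambda>_. 1 :: nat) \<noteq> (\<lambda>_. 0)" "(\<lambda>_. Suc 0) \<noteq> (\<lambda>_. 0)"
  by (simp_all add: fun_eq_iff)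

text \<open>Of the four products in \<open>Z2\<close>, three involve the unit; the square of the
  generator is handled by \<open>\<sigma>\<close> being an involution.\<close>

lemma isometric_flip_action:
  assumes \<sigma>: "\<And>x. x \<in> M \<Longrightarrow> \<sigma> x \<in> M" "\<And>x. x \<in> M \<Longrightarrow> \<sigma> (\<sigma> x) = x"
    and d: "\<And>x y. x \<in> M \<Longrightarrow> y \<in> M \<Longrightarrow> d (\<sigma> x) (\<sigma> y) = d x y"
  shows "isometric_action Z2 M d (flip_action M \<sigma>)"
proof -
  have Bij: "flip_action M \<sigma> g \<in> Bij M" for g
    unfolding Bij_def flip_action_def
    by (auto intro!: bij_betwI[where g = "if g = (\<lambda>_. 0) then id else \<sigma>"] simp: \<sigma>)
  have eq: "flip_action M \<sigma> (\<lambda>_. 0) = (\<lambda>x\<in>M. x)" "flip_action M \<sigma> (\<lambda>_. 1) = restrict \<sigma> M"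
    by (simp_all add: flip_action_def)
  have inv: "compose M (restrict \<sigma> M) (restrict \<sigma> M) = (\<lambda>x\<in>M. x)"
    using \<sigma> by (auto simp: compose_def fun_eq_iff)
  have unit: "compose M (restrict \<sigma> M) (\<lambda>x\<in>M. x) = restrict \<sigma> M"
    "compose M (\<lambda>x\<in>M. x) (restrict \<sigma> M) = restrict \<sigma> M"
    "compose M (\<lambda>x\<in>M. x) (\<lambda>x\<in>M. x) = (\<lambda>x\<in>M. x)"
    using \<sigma> by (auto simp: compose_def fun_eq_iff)
  have Bij': "(\<lambda>x\<in>M. x) \<in> Bij M" "restrict \<sigma> M \<in> Bij M"
    using Bij[of "\<lambda>_. 0"] Bij[of "\<lambda>_. 1"] unfolding eq by auto
  have "flip_action M \<sigma> (g \<otimes>\<^bsub>Z2\<^esub> h) = flip_action M \<sigma> g \<otimes>\<^bsub>BijGroup M\<^esub> flip_action M \<sigma> h"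
    if "g \<in> carrier Z2" "h \<in> carrier Z2" for g h
    using that inv unit Bij' eq[simplified]
    by (auto simp: Z2_def BijGroup_def)
  then have "flip_action M \<sigma> \<in> hom Z2 (BijGroup M)"
    using Bij by (intro homI) (auto simp: BijGroup_def)
  then have "group_action Z2 M (flip_action M \<sigma>)"
    unfolding group_action_def group_hom_def group_hom_axioms_def
    using group_Z2 group_BijGroup by blast
  then show ?thesis
    using d by (auto simp: isometric_action_def carrier_Z2 flip_action_def)
qed

text \<open>The set in question lies in a finite carrier for every radius; \<open>1\<close> is
  taken.\<close>

lemma proper_flip_action: "proper_action Z2 M d (flip_action M \<sigma>)"
  unfolding proper_action_def
proof (intro ballI exI conjI)
  show "finite {g \<in> carrier Z2. P g}" for P
    by (rule finite_subset[of _ "carrier Z2"]) (auto simp: carrier_Z2)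
qed (rule zero_less_one)

lemma orbit_flip_action:
  assumes "x \<in> M"
  shows "orbit Z2 (flip_action M \<sigma>) x = {x, \<sigma> x}"
proof -
  have "orbit Z2 (flip_action M \<sigma>) x = (\<lambda>g. flip_action M \<sigma> g x) ` {\<lambda>_. 0, \<lambda>_. 1}"
    unfolding orbit_def carrier_Z2 Setcompr_eq_image ..
  then show ?thesis
    using assms by (simp add: flip_action_def insert_commute)
qed

lemma orbits_flip_action:
  "X \<subseteq> M \<Longrightarrow> orbits Z2 X (flip_action M \<sigma>) = (\<lambda>x. {x, \<sigma> x}) ` X"
  unfolding orbits_def Setcompr_eq_image by (intro image_cong refl orbit_flip_action) auto

lemma invariant_subset_flip_action:
  assumes "X \<subseteq> M" "\<And>x. x \<in> X \<Longrightarrow> \<sigma> x \<in> X"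
  shows "invariant_subset Z2 (flip_action M \<sigma>) X"
proof -
  have "x \<in> {flip_action M \<sigma> g y | g y. g \<in> carrier Z2 \<and> y \<in> X}" if "x \<in> X" for x
    using that assms(1)
    by (intro CollectI exI[of _ "\<lambda>_. 0"] exI[of _ x]) (auto simp: carrier_Z2 flip_action_def)
  then show ?thesis
    using assms by (auto simp: invariant_subset_def carrier_Z2 flip_action_def subset_iff)
qed

lemma orbit_dist_flip_action:
  assumes "isometric_action Z2 M d (flip_action M \<sigma>)" "x \<in> M" "y \<in> M"
  shows "orbit_dist Z2 d (flip_action M \<sigma>) {x, \<sigma> x} {y, \<sigma> y} = min (d x y) (d x (\<sigma> y))"
  using orbit_dist_orbit[OF assms] assms(2,3)
  by (simp add: orbit_flip_action carrier_Z2 flip_action_def cInf_eq_Min)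

section \<open>A space of twins at shrinking heights\<close>

text \<open>The height tells the block, the label the place within the block, and the sign of the
  offset tells twins apart. The other coordinates of the points are \<open>0\<close>.\<close>

abbreviation height :: "(nat \<Rightarrow> real) \<Rightarrow> real" where "height x \<equiv> x 0"
abbreviation label :: "(nat \<Rightarrow> real) \<Rightarrow> real" where "label x \<equiv> x (Suc 0)"
abbreviation offset :: "(nat \<Rightarrow> real) \<Rightarrow> real" where "offset x \<equiv> x 2"

definition pt :: "real \<Rightarrow> real \<Rightarrow> real \<Rightarrow> nat \<Rightarrow> real" where
  "pt h l t = (\<lambda>_. 0)(0 := h, Suc 0 := l, 2 := t)"

text \<open>Points at different places are as far apart as the higher one is from the limit point
  \<open>pt 0 0 0\<close>. The absolute values give nonnegativity for all functions, as
  \<open>Metric_space\<close> demands.\<close>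

definition twin_dist :: "(nat \<Rightarrow> real) \<Rightarrow> (nat \<Rightarrow> real) \<Rightarrow> real" where
  "twin_dist x y =
     (if height x = height y \<and> label x = label y then \<bar>offset x - offset y\<bar>
      else max \<bar>height x\<bar> \<bar>height y\<bar>)"

definition flip :: "(nat \<Rightarrow> real) \<Rightarrow> nat \<Rightarrow> real" where
  "flip x = x(2 := - offset x)"

text \<open>The choice is harmless on orbits, since twins have the same height.\<close>

definition orbit_height :: "(nat \<Rightarrow> real) set \<Rightarrow> real" where
  "orbit_height A = \<bar>height (SOME x. x \<in> A)\<bar>"

text \<open>A closed form for \<open>orbit_dist\<close>, correct on orbits of points of the space by
  \<open>orbit_dist_twins\<close>. It is visibly nonnegative and symmetric on all sets.\<close>

definition twin_orbit_dist :: "(nat \<Rightarrow> real) set \<Rightarrow> (nat \<Rightarrow> real) set \<Rightarrow> real" where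
  "twin_orbit_dist A B = (if A = B then 0 else max (orbit_height A) (orbit_height B))"

lemma pt_simps [simp]: "height (pt h l t) = h" "label (pt h l t) = l" "offset (pt h l t) = t"
  by (simp_all add: pt_def)

lemma pt_eq_iff [simp]: "pt h l t = pt h' l' t' \<longleftrightarrow> h = h' \<and> l = l' \<and> t = t'"
  by (metis pt_simps)

lemma flip_simps [simp]:
  "height (flip x) = height x" "label (flip x) = label x" "offset (flip x) = - offset x"
  "flip (flip x) = x" "flip (pt h l t) = pt h l (- t)"
  by (auto simp: flip_def pt_def)

lemma flip_eq_self: "offset x = 0 \<Longrightarrow> flip x = x"
  by (simp add: flip_def fun_upd_idem)

lemma orbit_height_twins [simp]: "orbit_height {x, flip x} = \<bar>height x\<bar>"
proof -
  have "(SOME y. y \<in> {x, flip x}) \<in> {x, flip x}"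
    by (rule someI[of _ x]) simp
  then show ?thesis
    by (auto simp: orbit_height_def)
qed

locale twin_space =
  fixes N :: nat
  assumes N: "2 \<le> N"
begin

text \<open>The ratio \<open>1 / (4 * N)\<close> makes everything below block \<open>j\<close> small
  compared with \<open>ht j / N\<close>, the least distance between points of block
  \<open>j\<close>.\<close>

definition ht :: "nat \<Rightarrow> real" where "ht j = (1 / (4 * real N)) ^ j"

definition off :: "nat \<Rightarrow> real" where "off i = (if i < N then real i / (2 * real N) else 0)"

text \<open>In every block of constant height the twins with label \<open>i < N\<close> are \<open>i / N\<close> times the height
  apart. The points with labels \<open>0\<close> and \<open>N\<close> are their own twins.\<close>

definition M :: "(nat \<Rightarrow> real) set" where
  "M = insert (pt 0 0 0) {pt (ht j) (real i) t | j i t. i \<le> N \<and> \<bar>t\<bar> = ht j * off i}"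

lemma N_pos: "0 < real N" using N by simp

lemma ht_pos [simp]: "0 < ht j"
  using N_pos by (simp add: ht_def)

lemma ht_Suc: "ht (Suc j) = ht j / (4 * real N)"
  by (simp add: ht_def)

lemma ht_less_iff [simp]: "ht j < ht k \<longleftrightarrow> k < j"
  unfolding ht_def using N by (intro power_strict_decreasing_iff) auto

lemma ht_eq_iff [simp]: "ht j = ht k \<longleftrightarrow> j = k"
  using ht_less_iff[of j k] ht_less_iff[of k j] by (metis less_irrefl linorder_neqE_nat)

lemma ht_le_1: "ht j \<le> 1"
  unfolding ht_def using N by (intro power_le_one) auto

lemma off_le: "off i \<le> 1 / 2"
  using N by (auto simp: off_def field_simps)

lemma off_ge: "off i \<noteq> 0 \<Longrightarrow> 1 / (2 * real N) \<le> off i"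
  using N by (auto simp: off_def divide_simps split: if_splits)

lemma pt_in_M: "i \<le> N \<Longrightarrow> \<bar>t\<bar> = ht j * off i \<Longrightarrow> pt (ht j) (real i) t \<in> M"
  by (auto simp: M_def)

lemma zero_in_M: "pt 0 0 0 \<in> M"
  by (simp add: M_def)

lemma M_cases [consumes 1, case_names limit twin]:
  assumes "x \<in> M"
  obtains "x = pt 0 0 0"
  | j i t where "x = pt (ht j) (real i) t" "i \<le> N" "\<bar>t\<bar> = ht j * off i"
  using assms by (auto simp: M_def)

lemma height_bounds:
  assumes "x \<in> M"
  shows "0 \<le> height x" "height x \<le> 1"
  using assms less_imp_le[OF ht_pos] ht_le_1 by (cases rule: M_cases; simp)+

lemma height_eq_0: "x \<in> M \<Longrightarrow> height x = 0 \<Longrightarrow> x = pt 0 0 0"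
  using less_imp_neq[OF ht_pos] by (elim M_cases) auto

text \<open>This gives the triangle inequality for twins and a detour through another place: each
  leg is at least the height of the twins.\<close>

lemma offset_le:
  assumes "x \<in> M"
  shows "2 * \<bar>offset x\<bar> \<le> height x"
  using assms
proof (cases rule: M_cases)
  case (twin j i t)
  have "ht j * off i \<le> ht j * (1 / 2)"
    using off_le less_imp_le[OF ht_pos] by (rule mult_left_mono)
  then show ?thesis using twin by simp
qed simp

text \<open>Height and label determine \<open>j\<close> and \<open>i\<close>, and these determine
  the offset up to sign.\<close>

lemma same_place:
  assumes "x \<in> M" "y \<in> M" "height x = height y" "label x = label y"
  shows "y = x \<or> y = flip x"
  using assms(1)
proof (cases rule: M_cases)
  case limit
  then show ?thesis using assms(2,3) height_eq_0[of y] by simp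
next
  case x: (twin j i t)
  show ?thesis
    using assms(2)
  proof (cases rule: M_cases)
    case limit
    then show ?thesis using assms(3) x(1) ht_pos[of j] by (simp del: ht_pos)
  next
    case y: (twin k l s)
    then have "k = j" "l = i" using assms(3,4) x by simp_all
    then have "s = t \<or> s = - t" using x(3) y(3) by (simp flip: abs_eq_iff)
    then show ?thesis using \<open>k = j\<close> \<open>l = i\<close> x(1) y(1) by auto
  qed
qed

text \<open>The next height below \<open>ht j\<close> is \<open>ht (Suc j)\<close>.\<close>

lemma height_gap:
  assumes "x \<in> M" "height x < ht j"
  shows "height x \<le> ht j / (4 * real N)"
  using assms(1)
proof (cases rule: M_cases)
  case (twin k i t)
  then have "\<not> k < Suc j" using assms(2) by simp
  then have "\<not> ht (Suc j) < ht k" by simp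
  then show ?thesis using twin by (simp add: ht_Suc)
qed (use ht_pos[of j] N_pos in \<open>simp add: less_imp_le\<close>)

lemma flip_in_M: "x \<in> M \<Longrightarrow> flip x \<in> M"
  by (elim M_cases) (auto simp: zero_in_M intro!: pt_in_M)

lemma ht_tends: "0 < r \<Longrightarrow> \<exists>j. ht j < r"
  unfolding ht_def using N by (intro real_arch_pow_inv) auto

text \<open>Only finitely many blocks reach up to \<open>r\<close>, and a point of a block is given
  by its label and a sign.\<close>

lemma finite_high:
  assumes "0 < r"
  shows "finite {x \<in> M. r \<le> height x}"
proof -
  obtain J where J: "ht J < r" using ht_tends[OF assms] by blast
  let ?S = "(\<lambda>(j, i, s). pt (ht j) (real i) (s * (ht j * off i))) ` ({..J} \<times> {..N} \<times> {-1, 1})"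
  have "x \<in> ?S" if "x \<in> M" "r \<le> height x" for x
    using that(1)
  proof (cases rule: M_cases)
    case (twin j i t)
    then have "ht J < ht j" using that(2) J by (simp del: ht_less_iff)
    then have "j \<le> J" by simp
    moreover have "t = 1 * (ht j * off i) \<or> t = -1 * (ht j * off i)"
      using twin(3) by (auto simp: abs_if split: if_splits)
    ultimately show ?thesis using twin(1,2) by (force simp: image_iff)
  qed (use that assms in simp)
  then have "{x \<in> M. r \<le> height x} \<subseteq> ?S" by blast
  then show ?thesis by (rule finite_subset) simp
qed

section \<open>The metric and its compactness\<close>

sublocale Metric_space M twin_dist
proof
  fix x y
  show "0 \<le> twin_dist x y" "twin_dist x y = twin_dist y x"
    by (auto simp: twin_dist_def)
next
  fix x y assume xy: "x \<in> M" "y \<in> M"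
  have "x = y" if "twin_dist x y = 0"
  proof (cases "height x = height y \<and> label x = label y")
    case True
    then have eq: "offset x = offset y"
      using that by (simp add: twin_dist_def)
    from True consider "y = x" | "y = flip x" using same_place[OF xy] by blast
    then show ?thesis
    proof cases
      case 2
      then have "offset x = 0" using eq by simp
      then show ?thesis using 2 flip_eq_self by metis
    qed simp
  next
    case False
    then have "height x = 0" "height y = 0"
      using that by (auto simp: twin_dist_def max_def split: if_splits)
    then show ?thesis using xy[THEN height_eq_0] by simp
  qed
  then show "twin_dist x y = 0 \<longleftrightarrow> x = y"
    by (auto simp: twin_dist_def)
next
  fix x y z assume "x \<in> M" "y \<in> M" "z \<in> M"
  then show "twin_dist x z \<le> twin_dist x y + twin_dist y z"
    using height_bounds(1)[of x] height_bounds(1)[of y] height_bounds(1)[of z]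
      offset_le[of x] offset_le[of y] offset_le[of z]
    by (auto simp: twin_dist_def max_def abs_if split: if_splits)
qed

lemma twin_dist_zero: "x \<in> M \<Longrightarrow> twin_dist (pt 0 0 0) x = height x"
  using height_eq_0[of x] height_bounds[of x] by (auto simp: twin_dist_def)

text \<open>A member of the cover around the limit point contains a ball, and only finitely many
  points are outside that ball by \<open>finite_high\<close>.\<close>

lemma compact_M: "compact_space mtopology"
  unfolding compact_space_def compactin_def topspace_mtopology
proof (intro conjI allI impI)
  fix \<U> assume "(\<forall>U\<in>\<U>. openin mtopology U) \<and> M \<subseteq> \<Union>\<U>"
  then have op: "\<And>U. U \<in> \<U> \<Longrightarrow> openin mtopology U" and cov: "M \<subseteq> \<Union>\<U>" by auto
  obtain V where V: "V \<in> \<U>" "pt 0 0 0 \<in> V" using cov zero_in_M by blast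
  then obtain r where r: "0 < r" "mball (pt 0 0 0) r \<subseteq> V"
    using op openin_mtopology by metis
  have "\<forall>x\<in>M. \<exists>U. U \<in> \<U> \<and> x \<in> U" using cov by blast
  then obtain U where "\<forall>x\<in>M. U x \<in> \<U> \<and> x \<in> U x" by (rule bchoice[THEN exE])
  then have U: "\<And>x. x \<in> M \<Longrightarrow> U x \<in> \<U>" "\<And>x. x \<in> M \<Longrightarrow> x \<in> U x" by blast+
  let ?F = "insert V (U ` {x \<in> M. r \<le> height x})"
  have "M \<subseteq> \<Union>?F"
  proof
    fix x assume "x \<in> M"
    then show "x \<in> \<Union>?F"
      using U(2) r(2) zero_in_M by (cases "r \<le> height x") (auto simp: twin_dist_zero subset_iff)
  qed
  then show "\<exists>\<F>. finite \<F> \<and> \<F> \<subseteq> \<U> \<and> M \<subseteq> \<Union>\<F>"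
    using finite_high[OF r(1)] V(1) U(1) by (intro exI[of _ ?F]) blast
qed simp

lemma twin_dist_le_1: "x \<in> M \<Longrightarrow> y \<in> M \<Longrightarrow> twin_dist x y \<le> 1"
  using height_bounds[of x] height_bounds[of y] offset_le[of x] offset_le[of y]
  by (auto simp: twin_dist_def)

lemma isometric: "isometric_action Z2 M twin_dist (flip_action M flip)"
  by (rule isometric_flip_action) (auto simp: flip_in_M twin_dist_def)

section \<open>Deleting a point that is its own twin\<close>

text \<open>The point to be deleted; \<open>pt (ht j) 0 0\<close> is the other point of block
  \<open>j\<close> that is its own twin.\<close>

definition q :: "nat \<Rightarrow> nat \<Rightarrow> real" where "q j = pt (ht j) (real N) 0"

lemma q_in_M: "q j \<in> M"
  unfolding q_def by (rule pt_in_M) (auto simp: off_def)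

lemma flip_eq_q_iff: "flip x = q j \<longleftrightarrow> x = q j"
  by (metis add.inverse_neutral flip_simps(4,5) q_def)

text \<open>The other self-twin point \<open>?p\<close> of the block is at distance
  \<open>ht j\<close> from \<open>q j\<close>; the factor \<open>2\<close> provides the strict
  inequality in \<open>thickening\<close>.\<close>

lemma hausdorff_dist_delete: "hausdorff_dist M twin_dist (M - {q j}) M \<le> 2 * ht j"
proof (rule hausdorff_dist_le)
  let ?p = "pt (ht j) 0 0"
  have "?p \<in> M - {q j}"
    using pt_in_M[of 0 0 j] N_pos by (simp add: off_def q_def)
  moreover have "twin_dist (q j) ?p < 2 * ht j"
    using ht_pos[of j] N_pos by (simp add: twin_dist_def q_def abs_of_pos)
  ultimately have "q j \<in> thickening M twin_dist (M - {q j}) (2 * ht j)"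
    using q_in_M by (auto simp: thickening_def)
  moreover have "x \<in> thickening M twin_dist (M - {q j}) (2 * ht j)" if "x \<in> M" "x \<noteq> q j" for x
    using that by (auto simp: thickening_def intro!: bexI[of _ x])
  ultimately show "M \<subseteq> thickening M twin_dist (M - {q j}) (2 * ht j)"
    by blast
  show "M - {q j} \<subseteq> thickening M twin_dist M (2 * ht j)"
    by (auto simp: thickening_def intro!: bexI)
qed simp

text \<open>The inverse of the splitting of \<open>p\<close> and stretching of the pairs described at the top: only in
  this direction is the correspondence a map, and it is a contraction.\<close>

definition hop :: "nat \<Rightarrow> real" where "hop j = ht j / (2 * real N)"

definition shift :: "nat \<Rightarrow> (nat \<Rightarrow> real) \<Rightarrow> nat \<Rightarrow> real" where
  "shift j x =
     (if height x \<noteq> ht j then x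
      else if label x = 0 then pt (ht j) (real N - 1) ((real N - 1) * hop j)
      else if label x = real N then pt (ht j) (real N - 1) (- ((real N - 1) * hop j))
      else pt (ht j) (label x - 1) (offset x - sgn (offset x) * hop j))"

lemma hop_pos [simp]: "0 < hop j"
  using N_pos by (simp add: hop_def)

lemma hop_nonneg [simp]: "0 \<le> hop j"
  using hop_pos by (rule less_imp_le)

lemma hop_nonzero [simp]: "hop j \<noteq> 0"
  using hop_pos by (rule less_imp_neq[symmetric])

text \<open>\<open>hop j\<close> serves as unit of length in block \<open>j\<close>: the height is
  \<open>2 * N\<close> units, and the twins labelled \<open>i < N\<close> have offsets of
  \<open>i\<close> units up to sign.\<close>

lemma ht_eq_hop: "ht j = 2 * real N * hop j"
  using N_pos by (simp add: hop_def)

lemma ht_times_off: "i < N \<Longrightarrow> ht j * off i = real i * hop j"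
  by (simp add: off_def hop_def)

lemma height_shift [simp]: "height (shift j x) = height x"
  by (simp add: shift_def)

text \<open>Lists the points of block \<open>j\<close> together with their images. The middle label
  is written \<open>i + 1\<close> so that the shifted one is a natural number, and \<open>s\<close>
  tells the twins apart.\<close>

lemma block_cases [consumes 2, case_names first last middle]:
  assumes "x \<in> M" "height x = ht j"
  obtains "x = pt (ht j) 0 0" "shift j x = pt (ht j) (real N - 1) ((real N - 1) * hop j)"
  | "x = q j" "shift j x = pt (ht j) (real N - 1) (- ((real N - 1) * hop j))"
  | i s where "s = 1 \<or> s = -1" "i + 1 < N"
      "x = pt (ht j) (real i + 1) (s * ((real i + 1) * hop j))"
      "shift j x = pt (ht j) (real i) (s * (real i * hop j))"
  using assms(1)
proof (cases rule: M_cases)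
  case limit
  then show ?thesis using assms(2) ht_pos[of j] by (simp del: ht_pos)
next
  case (twin k i t)
  then have "k = j" using assms(2) by simp
  consider "i = 0" | "i = N" | m where "i = m + 1" "m + 1 < N"
    using twin(2) by (metis Suc_eq_plus1 le_neq_implies_less not0_implies_Suc)
  then show ?thesis
  proof cases
    case 1
    then have "x = pt (ht j) 0 0" using twin \<open>k = j\<close> N by (simp add: off_def split: if_splits)
    moreover from this have "shift j x = pt (ht j) (real N - 1) ((real N - 1) * hop j)"
      by (simp add: shift_def)
    ultimately show ?thesis by (rule that(1))
  next
    case 2
    then have x: "x = pt (ht j) (real N) 0" using twin \<open>k = j\<close> by (simp add: off_def)
    then have "shift j x = pt (ht j) (real N - 1) (- ((real N - 1) * hop j))"
      using N_pos by (simp add: shift_def)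
    with x show ?thesis by (intro that(2)) (simp add: q_def)
  next
    case (3 m)
    have "\<bar>t\<bar> = (real m + 1) * hop j"
      using twin(3) 3 \<open>k = j\<close> ht_times_off[of i j] by simp
    moreover from this have "t \<noteq> 0" by auto
    moreover define s where "s = sgn t"
    ultimately have s: "s = 1 \<or> s = -1" "t = s * ((real m + 1) * hop j)" "sgn t = s"
      using sgn_mult_abs[of t] by (auto simp: sgn_if)
    have x: "x = pt (ht j) (real m + 1) (s * ((real m + 1) * hop j))"
      using twin(1) 3(1) \<open>k = j\<close> s(2) by simp
    have "real m + 1 \<noteq> real N" using 3(2) by linarith
    then have "shift j x = pt (ht j) (real m) (t - s * hop j)"
      unfolding shift_def using x s(2,3) by simp
    also have "t - s * hop j = s * (real m * hop j)"
      unfolding s(2) by (simp add: algebra_simps)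
    finally show ?thesis using that(3)[OF s(1) 3(2) x] by blast
  qed
qed

lemma twin_dist_same_height:
  "twin_dist (pt (ht j) l t) (pt (ht j) l' t') = (if l = l' then \<bar>t - t'\<bar> else 2 * real N * hop j)"
  by (simp add: twin_dist_def abs_of_pos flip: ht_eq_hop)

text \<open>Distances between blocks depend on heights only, and these are kept. Inside block
  \<open>j\<close>, in units of \<open>hop j\<close>, twins come closer from
  \<open>2 * (i + 1)\<close> to \<open>2 * i\<close>, and the two self-twin points from
  \<open>2 * N\<close> to \<open>2 * N - 2\<close>; all other pairs keep their distance.\<close>

lemma shift_dist:
  assumes x: "x \<in> M" and y: "y \<in> M"
  shows "twin_dist (shift j x) (shift j y) \<le> twin_dist x y \<and>
    twin_dist x y \<le> twin_dist (shift j x) (shift j y) + 2 * hop j"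
proof (cases "height x = ht j \<and> height y = ht j")
  case False
  have "twin_dist (shift j x) (shift j y) = twin_dist x y"
  proof (cases "height x = height y")
    case True
    then have "shift j x = x" "shift j y = y" using False by (simp_all add: shift_def)
    then show ?thesis by simp
  qed (simp add: twin_dist_def)
  then show ?thesis by (simp add: less_imp_le)
next
  case True
  \<comment> \<open>The images of the two self-twin points are the twins labelled
    \<open>N - 1\<close>.\<close>
  have wide: "\<bar>(real N - 1) * hop j - (- ((real N - 1) * hop j))\<bar> = 2 * real N * hop j - 2 * hop j"
  proof -
    have "0 \<le> (real N - 1) * hop j" using N by (intro mult_nonneg_nonneg) simp_all
    then show ?thesis by (simp add: algebra_simps)
  qed
  note dist = twin_dist_same_height q_def
  have first_last: "twin_dist (pt (ht j) 0 0) (q j) = 2 * real N * hop j"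
    using N by (simp add: dist)
  show ?thesis
    using x conjunct1[OF True]
  proof (cases rule: block_cases)
    case x: first
    show ?thesis using y conjunct2[OF True]
    proof (cases rule: block_cases)
      case first
      then show ?thesis using x by (simp add: dist)
    next
      case last
      have "twin_dist (shift j x) (shift j y) = 2 * real N * hop j - 2 * hop j"
        unfolding x(2) last(2) twin_dist_same_height using wide by simp
      then show ?thesis using first_last x(1) last(1) by simp
    next
      case (middle k r)
      then show ?thesis using x by (simp add: dist)
    qed
  next
    case x: last
    show ?thesis using y conjunct2[OF True]
    proof (cases rule: block_cases)
      case first
      have "twin_dist (shift j y) (shift j x) = 2 * real N * hop j - 2 * hop j"
        unfolding x(2) first(2) twin_dist_same_height using wide by simp
      then show ?thesis using first_last x(1) first(1) by (simp add: commute)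
    next
      case last
      then show ?thesis using x by (simp add: dist)
    next
      case (middle k r)
      then show ?thesis using x by (simp add: dist)
    qed
  next
    case x: (middle i s)
    show ?thesis using y conjunct2[OF True]
    proof (cases rule: block_cases)
      case first
      then show ?thesis using x by (simp add: dist)
    next
      case last
      then show ?thesis using x by (simp add: dist)
    next
      case y: (middle k r)
      show ?thesis
      proof (cases "k = i")
        case True
        \<comment> \<open>For opposite signs the two distances are \<open>2 * b + 2 * hop j\<close>
          and \<open>2 * b\<close>; for equal signs both vanish.\<close>
        define b where "b = real i * hop j"
        have b: "0 \<le> b" "(real i + 1) * hop j = b + hop j"
          by (simp_all add: b_def algebra_simps)
        have "twin_dist x y = \<bar>s * (b + hop j) - r * (b + hop j)\<bar>"
          unfolding x(3) y(3) True twin_dist_same_height b(2) by simp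
        moreover have "twin_dist (shift j x) (shift j y) = \<bar>s * b - r * b\<bar>"
          unfolding x(4) y(4) True twin_dist_same_height b_def by simp
        ultimately show ?thesis using x(1) y(1) b(1) hop_pos[of j] by (auto simp: abs_if simp del: hop_pos)
      next
        case False
        then show ?thesis using x y by (simp add: dist)
      qed
    qed
  qed
qed

text \<open>All images in block \<open>j\<close> have labels below \<open>N\<close>, so
  \<open>q j\<close> is missed. Conversely, a label \<open>k < N - 1\<close> is reached from
  \<open>k + 1\<close>, and the twins labelled \<open>N - 1\<close> from the two self-twin
  points.\<close>

lemma shift_image: "shift j ` M = M - {q j}"
proof (intro equalityI subsetI)
  fix y assume "y \<in> shift j ` M"
  then obtain x where x: "x \<in> M" "y = shift j x" by blast
  have "shift j x \<in> M \<and> shift j x \<noteq> q j"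
  proof (cases "height x = ht j")
    case False
    then show ?thesis using x(1) by (auto simp: shift_def q_def)
  next
    case True
    have rN: "real (N - 1) = real N - 1" using N by (simp add: of_nat_diff)
    have "\<bar>(real N - 1) * hop j\<bar> = ht j * off (N - 1)"
      using N ht_times_off[of "N - 1" j] rN by (simp add: abs_mult abs_of_pos)
    then have last: "pt (ht j) (real N - 1) ((real N - 1) * hop j) \<in> M"
      "pt (ht j) (real N - 1) (- ((real N - 1) * hop j)) \<in> M"
      using pt_in_M[of "N - 1" _ j] unfolding rN by simp_all
    show ?thesis using x(1) True
    proof (cases rule: block_cases)
      case first
      then show ?thesis using last by (simp add: q_def)
    next
      case last': last
      then show ?thesis using last by (simp add: q_def)
    next
      case (middle i s)
      then have "pt (ht j) (real i) (s * (real i * hop j)) \<in> M"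
        using ht_times_off[of i j] by (intro pt_in_M) (auto simp: abs_mult abs_of_pos)
      then show ?thesis using middle by (auto simp: q_def)
    qed
  qed
  then show "y \<in> M - {q j}" using x by simp
next
  fix y assume "y \<in> M - {q j}"
  then have y: "y \<in> M" "y \<noteq> q j" by auto
  show "y \<in> shift j ` M"
  proof (cases "height y = ht j")
    case False
    then show ?thesis using y by (auto simp: shift_def image_iff intro!: bexI[of _ y])
  next
    case True
    obtain k t where k: "y = pt (ht j) (real k) t" "k \<le> N" "\<bar>t\<bar> = ht j * off k"
      using y(1)
    proof (cases rule: M_cases)
      case limit
      then show ?thesis using True ht_pos[of j] by (simp del: ht_pos)
    next
      case (twin j' i t)
      then show ?thesis using True by (intro that[of i t]) simp_all
    qed
    have "k \<noteq> N" using k(1,3) y(2) by (auto simp: q_def off_def)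
    then have t: "\<bar>t\<bar> = real k * hop j" "k < N" using k ht_times_off by auto
    show ?thesis
    proof (cases "k = N - 1")
      case True
      then have rk: "real k = real N - 1" using N by (simp add: of_nat_diff)
      have "t = (real N - 1) * hop j \<or> t = - ((real N - 1) * hop j)"
        using t(1) rk by (auto simp: abs_if split: if_splits)
      moreover have "shift j (pt (ht j) 0 0) = pt (ht j) (real N - 1) ((real N - 1) * hop j)"
        "shift j (q j) = pt (ht j) (real N - 1) (- ((real N - 1) * hop j))"
        using N_pos by (simp_all add: shift_def q_def)
      moreover have "pt (ht j) 0 0 \<in> M"
        using pt_in_M[of 0 0 j] N_pos by (simp add: off_def)
      ultimately show ?thesis using k(1) rk q_in_M by (metis image_eqI)
    next
      case False
      \<comment> \<open>For \<open>t = 0\<close> both twins with label \<open>1\<close> are mapped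
        to the same point; the definition then picks the sign \<open>1\<close>.\<close>
      define s :: real where "s = (if t < 0 then -1 else 1)"
      have ts: "t = s * (real k * hop j)" "s = 1 \<or> s = -1" "\<bar>s\<bar> = 1" using t(1) by (auto simp: s_def)
      define x where "x = pt (ht j) (real (k + 1)) (s * (real (k + 1) * hop j))"
      have "x \<in> M"
        unfolding x_def using False t(2) ts(3) ht_times_off[of "k + 1" j]
        by (intro pt_in_M) (auto simp: abs_mult abs_of_pos)
      have "sgn (s * (real (k + 1) * hop j)) = s"
        using ts(2) by (auto simp: sgn_mult)
      moreover have "real (k + 1) \<noteq> real N" using False t(2) by linarith
      ultimately have "shift j x = pt (ht j) (real k) (s * (real (k + 1) * hop j) - s * hop j)"
        by (simp add: shift_def x_def)
      also have "s * (real (k + 1) * hop j) - s * hop j = t"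
        unfolding ts(1) by (simp add: algebra_simps)
      finally show ?thesis using k(1) \<open>x \<in> M\<close> by (metis image_eqI)
    qed
  qed
qed

lemma gh_dist_delete_le: "gh_dist (M - {q j}) twin_dist M twin_dist \<le> hop j"
  by (rule gh_dist_le_contraction[OF subspace Metric_space_axioms shift_image])
    (auto simp: shift_dist)

section \<open>Counting separated points\<close>

text \<open>The finitely many points to be counted, with the limit point standing for everything
  below block \<open>j\<close>. In the pigeonhole argument \<open>retract j\<close> names the
  pieces.\<close>

definition core :: "nat \<Rightarrow> (nat \<Rightarrow> real) set" where
  "core j = insert (pt 0 0 0) {x \<in> M. ht j \<le> height x}"

definition retract :: "nat \<Rightarrow> (nat \<Rightarrow> real) \<Rightarrow> nat \<Rightarrow> real" where
  "retract j x = (if ht j \<le> height x then x else pt 0 0 0)"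

lemma core_subset: "core j \<subseteq> M"
  using zero_in_M by (auto simp: core_def)

lemma finite_core: "finite (core j)"
  using finite_high[OF ht_pos] by (simp add: core_def)

lemma q_in_core: "q j \<in> core j"
  using q_in_M[of j] by (simp add: core_def q_def)

lemma retract_in: "x \<in> M - {q j} \<Longrightarrow> retract j x \<in> core j - {q j}"
  by (auto simp: retract_def core_def q_def less_imp_neq)

text \<open>This lets \<open>retract j\<close> act on orbits.\<close>

lemma retract_flip: "retract j (flip x) = flip (retract j x)"
  by (simp add: retract_def)

lemma ht_mult_ge: "ht j / real N \<le> h" if "ht j \<le> h"
proof -
  have "ht j / real N \<le> ht j / 1" using N by (intro divide_left_mono) (simp_all add: less_imp_le)
  then show ?thesis using that by simp
qed

text \<open>The limit point is the only low point of the core, and two different points cannot both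
  be it.\<close>

lemma core_height:
  assumes "x \<in> core j" "y \<in> core j" "x \<noteq> y"
  shows "ht j \<le> max (height x) (height y)"
  using assms by (auto simp: core_def)

text \<open>The critical pairs are twins: if distinct, they are at least \<open>1 / N\<close> times
  their height apart.\<close>

lemma core_separated:
  assumes "x \<in> core j" "y \<in> core j" "x \<noteq> y"
  shows "ht j / real N \<le> twin_dist x y"
proof (cases "height x = height y \<and> label x = label y")
  case False
  then have "max (height x) (height y) \<le> twin_dist x y"
    by (auto simp: twin_dist_def)
  then show ?thesis using ht_mult_ge[OF core_height[OF assms]] by linarith
next
  case True
  have xy: "x \<in> M" "y \<in> M" using assms core_subset by blast+
  then have y: "y = flip x" using same_place[OF xy] True assms(3) by blast
  then have "twin_dist x y = 2 * \<bar>offset x\<bar>" by (simp add: twin_dist_def)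
  moreover have "ht j / real N \<le> 2 * \<bar>offset x\<bar>"
    using xy(1)
  proof (cases rule: M_cases)
    case limit
    then show ?thesis using y assms(3) by simp
  next
    case (twin k i t)
    have "t \<noteq> 0" using y assms(3) twin(1) by auto
    then have "off i \<noteq> 0" using twin(3) by auto
    then have off: "1 / (2 * real N) \<le> off i" by (rule off_ge)
    have "ht j \<le> ht k" using core_height[OF assms] y twin(1) by simp
    then have "ht j * (1 / (2 * real N)) \<le> ht k * off i"
      using off by (intro mult_mono) (simp_all add: less_imp_le)
    then show ?thesis using twin(1,3) by simp
  qed
  ultimately show ?thesis by simp
qed

lemma low_height:
  assumes "x \<in> M" "\<not> ht j \<le> height x"
  shows "height x \<le> ht j / (4 * real N)"
  using height_gap assms by simp

text \<open>Without \<open>q j\<close> there is one piece fewer than there are core points. The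
  pieces have size at most \<open>ht j / (4 * N)\<close> and core points are \<open>ht j / N\<close>
  apart; half the difference is the constant \<open>3 * ht j / (8 * N)\<close>.\<close>

lemma gh_dist_delete_pos: "0 < gh_dist (M - {q j}) twin_dist M twin_dist"
proof -
  have "0 < 3 * ht j / (8 * real N)" using N_pos by simp
  also have "\<dots> \<le> gh_dist (M - {q j}) twin_dist M twin_dist"
  proof (rule gh_dist_ge_pigeonhole[where A = "core j" and q = "q j" and c = "retract j" and
        s = "ht j / (4 * real N)" and B = 1])
    show "Metric_space (M - {q j}) twin_dist" by (rule subspace) blast
    have "pt 0 0 0 \<in> M - {q j}" using zero_in_M by (simp add: q_def less_imp_neq)
    then show "M - {q j} \<noteq> {}" by blast
    fix x y assume xy: "x \<in> M - {q j}" "y \<in> M - {q j}" "retract j x = retract j y"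
    \<comment> \<open>A high point cannot be merged with a low one, because the limit point has
      height \<open>0\<close>.\<close>
    then have "x = y \<or> \<not> ht j \<le> height x \<and> \<not> ht j \<le> height y"
      using ht_pos[of j] by (auto simp: retract_def split: if_splits simp del: ht_pos)
    then show "twin_dist x y \<le> ht j / (4 * real N)"
    proof
      assume "x = y"
      then show ?thesis using N_pos by (simp add: twin_dist_def less_imp_le)
    next
      assume "\<not> ht j \<le> height x \<and> \<not> ht j \<le> height y"
      then show ?thesis
        using low_height[of x j] low_height[of y j] xy(1,2) height_bounds(1)[of x]
          height_bounds(1)[of y] offset_le[of x] offset_le[of y]
        by (auto simp: twin_dist_def)
    qed
  next
    fix x y assume "x \<in> core j" "y \<in> core j" "x \<noteq> y"
    then have "ht j / real N \<le> twin_dist x y" by (rule core_separated)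
    then show "ht j / (4 * real N) + 2 * (3 * ht j / (8 * real N)) \<le> twin_dist x y" by simp
  qed (use Metric_space_axioms twin_dist_le_1 core_subset finite_core q_in_core retract_in in auto)
  finally show ?thesis .
qed

section \<open>The orbit space of the flip\<close>

definition twins :: "(nat \<Rightarrow> real) \<Rightarrow> (nat \<Rightarrow> real) set" where "twins x = {x, flip x}"

lemma twins_flip [simp]: "twins (flip x) = twins x"
  by (auto simp: twins_def)

lemma twins_eq_iff:
  assumes "x \<in> M" "y \<in> M"
  shows "twins x = twins y \<longleftrightarrow> height x = height y \<and> label x = label y"
proof
  assume "twins x = twins y"
  then have "x = y \<or> x = flip y" by (auto simp: twins_def)
  then show "height x = height y \<and> label x = label y" by auto
next
  assume "height x = height y \<and> label x = label y"
  then have "y = x \<or> y = flip x" using same_place[OF assms] by blast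
  then show "twins x = twins y" by auto
qed

lemma twin_orbit_dist_twins:
  assumes "x \<in> M" "y \<in> M"
  shows "twin_orbit_dist (twins x) (twins y) =
    (if twins x = twins y then 0 else max (height x) (height y))"
  using height_bounds(1)[OF assms(1)] height_bounds(1)[OF assms(2)]
  unfolding twin_orbit_dist_def twins_def orbit_height_twins by simp

lemma Metric_space_twins: "Metric_space (twins ` M) twin_orbit_dist"
proof
  have nonneg: "0 \<le> orbit_height A" for A by (simp add: orbit_height_def)
  fix A B C
  show "0 \<le> twin_orbit_dist A B" "twin_orbit_dist A B = twin_orbit_dist B A"
    using nonneg[of A] by (auto simp: twin_orbit_dist_def)
  show "twin_orbit_dist A C \<le> twin_orbit_dist A B + twin_orbit_dist B C"
    using nonneg[of A] nonneg[of B] nonneg[of C] by (auto simp: twin_orbit_dist_def)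
  assume "A \<in> twins ` M" "B \<in> twins ` M"
  then obtain x y where xy: "x \<in> M" "y \<in> M" and [simp]: "A = twins x" "B = twins y" by blast
  have "twins x = twins y" if "max (height x) (height y) = 0"
  proof -
    have "height x = 0" "height y = 0"
      using that xy[THEN height_bounds(1)] by (auto simp: max_def split: if_splits)
    then show ?thesis using xy[THEN height_eq_0] by simp
  qed
  then show "twin_orbit_dist A B = 0 \<longleftrightarrow> A = B"
    using xy by (auto simp: twin_orbit_dist_twins)
qed

text \<open>At the same place \<open>y\<close> or its twin equals \<open>x\<close>, so the minimum
  is \<open>0\<close>. At different places the offsets do not enter the distance, so both candidates
  agree.\<close>

lemma orbit_dist_twins:
  assumes "x \<in> M" "y \<in> M"
  shows "orbit_dist Z2 twin_dist (flip_action M flip) (twins x) (twins y) =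
    twin_orbit_dist (twins x) (twins y)"
proof -
  have eq: "orbit_dist Z2 twin_dist (flip_action M flip) (twins x) (twins y) =
      min (twin_dist x y) (twin_dist x (flip y))"
    unfolding twins_def by (rule orbit_dist_flip_action[OF isometric assms])
  show ?thesis
  proof (cases "height x = height y \<and> label x = label y")
    case True
    then have "y = x \<or> y = flip x" using same_place[OF assms] by blast
    then have "min (twin_dist x y) (twin_dist x (flip y)) = 0" by (auto simp: twin_dist_def)
    moreover have "twins x = twins y" using True twins_eq_iff[OF assms] by blast
    ultimately show ?thesis unfolding eq by (simp add: twin_orbit_dist_def)
  next
    case False
    then have "twin_dist x y = max (height x) (height y)" "twin_dist x (flip y) = max (height x) (height y)"
      using assms[THEN height_bounds(1)] by (auto simp: twin_dist_def)
    moreover have "twins x \<noteq> twins y" using False twins_eq_iff[OF assms] by blast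
    ultimately show ?thesis unfolding eq by (simp add: twin_orbit_dist_twins assms)
  qed
qed

text \<open>Passing to orbits removes the narrow gaps between twins: core orbits are now
  \<open>ht j\<close> apart, so the bound no longer shrinks with \<open>N\<close>. As
  \<open>N\<close> is at least \<open>2\<close>, the pieces have size at most
  \<open>ht j / 8\<close>, and \<open>1 / 8 + 2 / 4\<close> is less than \<open>1\<close>.\<close>

lemma gh_dist_twins_ge:
  "ht j / 4 \<le> gh_dist (twins ` (M - {q j})) twin_orbit_dist (twins ` M) twin_orbit_dist"
proof (rule gh_dist_ge_pigeonhole[where A = "twins ` core j" and q = "twins (q j)" and
      c = "\<lambda>A. retract j ` A" and s = "ht j / 8" and B = 1])
  have image: "retract j ` twins x = twins (retract j x)" for x
    by (simp add: twins_def retract_flip)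
  have tail: "height x \<le> ht j / 8" if "x \<in> M" "\<not> ht j \<le> height x" for x
  proof -
    have "ht j / (4 * real N) \<le> ht j / 8"
      using N by (intro divide_left_mono) (simp_all add: less_imp_le)
    then show ?thesis using low_height[OF that] by linarith
  qed
  show "Metric_space (twins ` (M - {q j})) twin_orbit_dist"
    by (rule Metric_space.subspace[OF Metric_space_twins]) blast
  have "pt 0 0 0 \<in> M - {q j}" using zero_in_M by (simp add: q_def less_imp_neq)
  then show "twins ` (M - {q j}) \<noteq> {}" by blast
  have le_1: "twin_orbit_dist A B \<le> 1" if "A \<in> twins ` M" "B \<in> twins ` M" for A B
    using that height_bounds(2) by (auto simp: twin_orbit_dist_twins)
  then show "twin_orbit_dist A B \<le> 1" if "A \<in> twins ` (M - {q j})" "B \<in> twins ` (M - {q j})" for A B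
    using that by blast
  show "twin_orbit_dist A B \<le> 1" if "A \<in> twins ` M" "B \<in> twins ` M" for A B
    using that by (rule le_1)
  show "retract j ` A \<in> twins ` core j - {twins (q j)}" if "A \<in> twins ` (M - {q j})" for A
  proof -
    obtain x where x: "x \<in> M - {q j}" "A = twins x" using \<open>A \<in> _\<close> by blast
    \<comment> \<open>\<open>q j\<close> is its own twin, so its whole orbit disappears with
      it.\<close>
    have "twins (retract j x) \<noteq> twins (q j)"
      using retract_in[OF x(1)] flip_eq_q_iff[of "retract j x" j] by (auto simp: twins_def)
    then show ?thesis using retract_in[OF x(1)] by (simp add: x(2) image)
  qed
  show "twin_orbit_dist A B \<le> ht j / 8"
    if A: "A \<in> twins ` (M - {q j})" and B: "B \<in> twins ` (M - {q j})" and eq: "retract j ` A = retract j ` B"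
    for A B
  proof -
    obtain x y where xy: "x \<in> M" "y \<in> M" and AB: "A = twins x" "B = twins y" using A B by blast
    have "retract j x \<in> M" "retract j y \<in> M" using xy zero_in_M by (auto simp: retract_def)
    then have "height (retract j x) = height (retract j y)" "label (retract j x) = label (retract j y)"
      using eq unfolding AB image by (simp_all add: twins_eq_iff)
    then have "twins x = twins y \<or> \<not> ht j \<le> height x \<and> \<not> ht j \<le> height y"
      using ht_pos[of j] xy
      by (auto simp: retract_def twins_eq_iff split: if_splits simp del: ht_pos)
    then show ?thesis
      using tail[OF xy(1)] tail[OF xy(2)] by (auto simp: AB xy twin_orbit_dist_twins less_imp_le)
  qed
  show "ht j / 8 + 2 * (ht j / 4) \<le> twin_orbit_dist A B"
    if "A \<in> twins ` core j" "B \<in> twins ` core j" "A \<noteq> B" for A B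
  proof -
    obtain x y where xy: "x \<in> core j" "y \<in> core j" and AB: "A = twins x" "B = twins y"
      using \<open>A \<in> _\<close> \<open>B \<in> _\<close> by blast
    then have "x \<noteq> y" using \<open>A \<noteq> B\<close> by auto
    then have "ht j \<le> max (height x) (height y)" by (rule core_height[OF xy])
    also have "\<dots> = twin_orbit_dist A B"
      using xy core_subset[of j] \<open>A \<noteq> B\<close> by (auto simp: AB twin_orbit_dist_twins subset_iff)
    finally show ?thesis using ht_pos[of j] by linarith
  qed
qed (use Metric_space_twins core_subset finite_core q_in_core in auto)

lemma gh_dist_orbits_ge:
  fixes j
  defines "X \<equiv> M - {q j}"
  shows "ht j / 4 \<le> gh_dist (orbits Z2 X (flip_action M flip)) (orbit_dist Z2 twin_dist (flip_action M flip))
    (orbits Z2 M (flip_action M flip)) (orbit_dist Z2 twin_dist (flip_action M flip))"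
proof -
  have orb: "orbits Z2 Y (flip_action M flip) = twins ` Y" if "Y \<subseteq> M" for Y
    unfolding twins_def using that by (rule orbits_flip_action)
  have "gh_dist (twins ` X) (orbit_dist Z2 twin_dist (flip_action M flip))
      (twins ` M) (orbit_dist Z2 twin_dist (flip_action M flip)) =
    gh_dist (twins ` X) twin_orbit_dist (twins ` M) twin_orbit_dist"
    by (rule gh_dist_cong) (auto simp: X_def orbit_dist_twins)
  then show ?thesis
    using gh_dist_twins_ge[of j] orb[of X] orb[of M] by (simp add: X_def)
qed

end

section \<open>Choice of the number of labels and of the scale\<close>

theorem theorem6p3:
  fixes n :: nat
  assumes "n > 0"
  shows "\<exists>(M :: (nat \<Rightarrow> real) set) (d :: (nat \<Rightarrow> real) \<Rightarrow> (nat \<Rightarrow> real) \<Rightarrow> real)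
          (G :: (nat \<Rightarrow> nat) monoid) (\<phi> :: (nat \<Rightarrow> nat) \<Rightarrow> (nat \<Rightarrow> real) \<Rightarrow> (nat \<Rightarrow> real)).
    Metric_space M d \<and> compact_space (Metric_space.mtopology M d) \<and>
    isometric_action G M d \<phi> \<and> proper_action G M d \<phi> \<and>
    (\<forall>\<delta>>0. \<exists>X. X \<subseteq> M \<and> X \<noteq> {} \<and> invariant_subset G \<phi> X \<and>
       hausdorff_dist M d X M < \<delta> \<and>
       gh_dist X d M d > 0 \<and>
       gh_dist (orbits G X \<phi>) (orbit_dist G d \<phi>) (orbits G M \<phi>) (orbit_dist G d \<phi>)
         / gh_dist X d M d \<ge> real n)"
proof -
  \<comment> \<open>For \<open>N = 2 * n\<close> the quotient of the two bounds,
    \<open>(ht j / 4) / hop j = N / 2\<close>, is exactly \<open>n\<close>.\<close>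
  interpret twin_space "2 * n"
    using assms by unfold_locales simp
  have "\<exists>X. X \<subseteq> M \<and> X \<noteq> {} \<and> invariant_subset Z2 (flip_action M flip) X \<and>
      hausdorff_dist M twin_dist X M < \<delta> \<and> gh_dist X twin_dist M twin_dist > 0 \<and>
      gh_dist (orbits Z2 X (flip_action M flip)) (orbit_dist Z2 twin_dist (flip_action M flip))
        (orbits Z2 M (flip_action M flip)) (orbit_dist Z2 twin_dist (flip_action M flip))
      / gh_dist X twin_dist M twin_dist \<ge> real n" if "0 < \<delta>" for \<delta>
  proof -
    \<comment> \<open>Half of \<open>\<delta>\<close>, because the Hausdorff bound is
      \<open>2 * ht j\<close>.\<close>
    obtain j where j: "ht j < \<delta> / 2" using ht_tends[of "\<delta> / 2"] \<open>0 < \<delta>\<close> by auto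
    show ?thesis
    proof (intro exI[of _ "M - {q j}"] conjI)
      show "M - {q j} \<subseteq> M" by blast
      show "M - {q j} \<noteq> {}"
        using zero_in_M by (auto simp: q_def less_imp_neq)
      show "invariant_subset Z2 (flip_action M flip) (M - {q j})"
        by (rule invariant_subset_flip_action) (auto simp: flip_in_M flip_eq_q_iff)
      show "hausdorff_dist M twin_dist (M - {q j}) M < \<delta>"
        using hausdorff_dist_delete[of j] j by linarith
      show pos: "0 < gh_dist (M - {q j}) twin_dist M twin_dist"
        by (rule gh_dist_delete_pos)
      have "real n * gh_dist (M - {q j}) twin_dist M twin_dist \<le> real n * hop j"
        using gh_dist_delete_le by (rule mult_left_mono) simp
      also have "\<dots> = ht j / 4"
        by (simp add: ht_eq_hop)
      also note gh_dist_orbits_ge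
      finally show "real n \<le> gh_dist (orbits Z2 (M - {q j}) (flip_action M flip))
          (orbit_dist Z2 twin_dist (flip_action M flip)) (orbits Z2 M (flip_action M flip))
          (orbit_dist Z2 twin_dist (flip_action M flip)) / gh_dist (M - {q j}) twin_dist M twin_dist"
        using pos by (simp add: pos_le_divide_eq)
    qed
  qed
  then show ?thesis
    using Metric_space_axioms compact_M isometric proper_flip_action by blast
qed

end
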